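(* The bound $\tilde p$ generated by the derived (aggregated) model is dominated by the bound $p$ using the entire oracle history, namely $$\tilde p(y)\le p(y),\qquad y\in\mathbb{E}.$$
   Context: $\mathbb{E}$ is an $n$-dimensional real vector space, $\mathbb{E}^*$ its dual, $\langle s,x\rangle$ the value of $s\in\mathbb{E}^*$ at $x\in\mathbb{E}$ (and $\langle\cdot,\cdot\rangle$ the standard inner product on $\mathbb{R}^m$). $B:\mathbb{E}\to\mathbb{E}^*$ is a symmetric positive definite linear operator, $\|x\|=\sqrt{\langle Bx,x\rangle}$ on $\mathbb{E}$ and $\|g\|_*=\sqrt{\langle g,B^{-1}g\rangle}$ on $\mathbb{E}^*$. $f:\mathbb{E}\to\mathbb{R}$ is convex and differentiable, with gradient Lipschitz continuous with constant $L_f>0$. Points $z_1,\dots,z_m\in\mathbb{E}$ ($m\ge1$) are given, with $f_i=f(z_i)$, $g_i=\nabla f(z_i)$. $\Delta_m$ is the standard simplex in $\mathbb{R}^m$. $G=(g_1,\dots,g_m)$ is the linear map $\mathbb{R}^m\to\mathbb{E}^*$, $G\lambda=\sum_i\lambda_ig_i$, with $(G^Ty)_i=\langle g_i,y\rangle$. Let $f_*,d_g\in\mathbb{R}^m$ with $(f_* )_i=\langle g_i,z_i\rangle-f_i$, $(d_g)_i=\|g_i\|_*^2$. The full-history bound is $$p(y)=\max_{\lambda\in\Delta_m}\left\{\left\langle\lambda,G^Ty-f_*+\tfrac{1}{2L_f}d_g\right\rangle-\tfrac{1}{2L_f}\|G\lambda\|_*^2\right\}.$$ Let $\tilde m\ge1$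 (not necessarily equal to $m$) and let $\mathcal{T}$ be an $m\times\tilde m$ real matrix all of whose columns $\mathcal{T}_i$, $i=1,\dots,\tilde m$, lie in $\Delta_m$. The derived model is $\tilde f_*=\mathcal{T}^Tf_*\in\mathbb{R}^{\tilde m}$, $\tilde G=G\mathcal{T}$ with columns $\tilde G_i\in\mathbb{E}^*$, and $\tilde d_g\in\mathbb{R}^{\tilde m}$ with $(\tilde d_g)_i=\|\tilde G_i\|_*^2$. The bound produced by it is $$\tilde p(y)=\max_{\tilde\lambda\in\Delta_{\tilde m}}\left\{\left\langle\tilde\lambda,\tilde G^Ty-\tilde f_*+\tfrac{1}{2L_f}\tilde d_g\right\rangle-\tfrac{1}{2L_f}\|\tilde G\tilde\lambda\|_*^2\right\}.$$ *)

theory Defs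
  imports "HOL-Analysis.Analysis"
begin

text \<open>
  The space is a type of class \<^class>\<open>euclidean_space\<close>, whose inner product is never used: it only
  provides finite dimension and the topology for derivatives. The dual space is the type of
  bounded linear functionals, which in finite dimension are all the linear functionals.
\<close>

type_synonym 'a dual = "'a \<Rightarrow>\<^sub>L real"

definition spd_operator :: "('a::euclidean_space \<Rightarrow> 'a dual) \<Rightarrow> bool" where
  "spd_operator B \<longleftrightarrow>
     linear B \<and>
     (\<forall>x y. blinfun_apply (B x) y = blinfun_apply (B y) x) \<and>
     (\<forall>x. x \<noteq> 0 \<longrightarrow> blinfun_apply (B x) x > 0)"

definition primal_norm :: "('a::euclidean_space \<Rightarrow> 'a dual) \<Rightarrow> 'a \<Rightarrow> real" where
  "primal_norm B x = sqrt (blinfun_apply (B x) x)"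

text \<open>
  An operator satisfying \<^const>\<open>spd_operator\<close> is bijective (lemma \<open>spd_operator_bij\<close> below),
  so \<open>inv B\<close> is a genuine inverse.
\<close>

definition dual_norm :: "('a::euclidean_space \<Rightarrow> 'a dual) \<Rightarrow> 'a dual \<Rightarrow> real" where
  "dual_norm B g = sqrt (blinfun_apply g (inv B g))"

text \<open>
  The derivative is an element of the dual space, and Lipschitz continuity is measured in the
  norms induced by \<open>B\<close> rather than in the norms of the types.
\<close>

definition has_gradient :: "('a::euclidean_space \<Rightarrow> real) \<Rightarrow> ('a \<Rightarrow> 'a dual) \<Rightarrow> bool" where
  "has_gradient f grad \<longleftrightarrow> (\<forall>x. (f has_derivative blinfun_apply (grad x)) (at x))"

definition lipschitz_gradient ::
    "('a::euclidean_space \<Rightarrow> 'a dual) \<Rightarrow> real \<Rightarrow> ('a \<Rightarrow> 'a dual) \<Rightarrow> bool" where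
  "lipschitz_gradient B L grad \<longleftrightarrow>
     (\<forall>x y. dual_norm B (grad x - grad y) \<le> L * primal_norm B (x - y))"

definition std_simplex :: "(real ^ 'm) set" where
  "std_simplex = {l. (\<forall>i. 0 \<le> l $ i) \<and> (\<Sum>i\<in>UNIV. l $ i) = 1}"

text \<open>
  A linear map from \<open>\<real>\<^sup>m\<close> to the dual space is represented by the vector of its columns;
  \<open>lin_apply G\<close> is the map itself and \<open>lin_transpose G\<close> its transpose.
\<close>

definition lin_apply :: "('a::euclidean_space dual) ^ 'm \<Rightarrow> real ^ 'm \<Rightarrow> 'a dual" where
  "lin_apply G l = (\<Sum>i\<in>UNIV. (l $ i) *\<^sub>R (G $ i))"

definition lin_transpose :: "('a::euclidean_space dual) ^ 'm \<Rightarrow> 'a \<Rightarrow> real ^ 'm" where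
  "lin_transpose G y = (\<chi> i. blinfun_apply (G $ i) y)"

definition col_sq_norms ::
    "('a::euclidean_space \<Rightarrow> 'a dual) \<Rightarrow> ('a dual) ^ 'm \<Rightarrow> real ^ 'm" where
  "col_sq_norms B G = (\<chi> i. (dual_norm B (G $ i))\<^sup>2)"

definition bound_objective ::
    "('a::euclidean_space \<Rightarrow> 'a dual) \<Rightarrow> real \<Rightarrow> real ^ 'm \<Rightarrow> ('a dual) ^ 'm \<Rightarrow>
     'a \<Rightarrow> real ^ 'm \<Rightarrow> real" where
  "bound_objective B L fs G y l =
     l \<bullet> (lin_transpose G y - fs + (1 / (2 * L)) *\<^sub>R col_sq_norms B G)
     - 1 / (2 * L) * (dual_norm B (lin_apply G l))\<^sup>2"

text \<open>
  The supremum is a maximum: see lemma \<open>model_bound_attained\<close> below.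
\<close>

definition model_bound ::
    "('a::euclidean_space \<Rightarrow> 'a dual) \<Rightarrow> real \<Rightarrow> real ^ 'm \<Rightarrow> ('a dual) ^ 'm \<Rightarrow> 'a \<Rightarrow> real" where
  "model_bound B L fs G y = (SUP l\<in>std_simplex. bound_objective B L fs G y l)"

definition history_G :: "('a::euclidean_space \<Rightarrow> 'a dual) \<Rightarrow> 'a ^ 'm \<Rightarrow> ('a dual) ^ 'm" where
  "history_G grad z = (\<chi> i. grad (z $ i))"

definition history_fstar ::
    "('a::euclidean_space \<Rightarrow> real) \<Rightarrow> ('a \<Rightarrow> 'a dual) \<Rightarrow> 'a ^ 'm \<Rightarrow> real ^ 'm" where
  "history_fstar f grad z = (\<chi> i. blinfun_apply (grad (z $ i)) (z $ i) - f (z $ i))"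

definition full_bound ::
    "('a::euclidean_space \<Rightarrow> 'a dual) \<Rightarrow> real \<Rightarrow> ('a \<Rightarrow> real) \<Rightarrow> ('a \<Rightarrow> 'a dual) \<Rightarrow> 'a ^ 'm \<Rightarrow>
     'a \<Rightarrow> real" where
  "full_bound B L f grad z y =
     model_bound B L (history_fstar f grad z) (history_G grad z) y"

definition derived_fstar :: "real ^ 'k ^ 'm \<Rightarrow> real ^ 'm \<Rightarrow> real ^ 'k" where
  "derived_fstar T fs = transpose T *v fs"

definition derived_G ::
    "real ^ 'k ^ 'm \<Rightarrow> ('a::euclidean_space dual) ^ 'm \<Rightarrow> ('a dual) ^ 'k" where
  "derived_G T G = (\<chi> i. lin_apply G (column i T))"

definition derived_bound ::
    "('a::euclidean_space \<Rightarrow> 'a dual) \<Rightarrow> real \<Rightarrow> ('a \<Rightarrow> real) \<Rightarrow> ('a \<Rightarrow> 'a dual) \<Rightarrow> 'a ^ 'm \<Rightarrow>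
     real ^ 'k ^ 'm \<Rightarrow> 'a \<Rightarrow> real" where
  "derived_bound B L f grad z T y =
     model_bound B L (derived_fstar T (history_fstar f grad z))
       (derived_G T (history_G grad z)) y"

lemma spd_operator_bij:
  fixes B :: "'a::euclidean_space \<Rightarrow> 'a dual"
  assumes "spd_operator B"
  shows "bij B"
proof -
  have lin: "linear B" and pos: "\<And>x. x \<noteq> 0 \<Longrightarrow> blinfun_apply (B x) x > 0"
    using assms by (auto simp: spd_operator_def)
  have injB: "inj B"
  proof (subst linear_injective_0[OF lin], intro allI impI)
    fix x assume "B x = 0"
    then show "x = 0" using pos[of x] by (cases "x = 0") auto
  qed
  define R :: "'a dual \<Rightarrow> 'a" where "R g = (\<Sum>b\<in>Basis. blinfun_apply g b *\<^sub>R b)" for g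
  have linR: "linear R"
    unfolding R_def by (rule linearI)
      (simp_all add: blinfun.add_left blinfun.scaleR_left scaleR_add_left sum.distrib
        scaleR_sum_right)
  have injR: "inj R"
  proof (subst linear_injective_0[OF linR], intro allI impI)
    fix g assume "R g = 0"
    then have "blinfun_apply g b = 0" if "b \<in> Basis" for b
      using that unfolding R_def by (metis inner_sum_left_Basis inner_zero_left)
    then show "g = 0" by (intro blinfun_euclidean_eqI) auto
  qed
  have "linear (R \<circ> B)" using lin linR by (rule linear_compose)
  moreover have "inj (R \<circ> B)" using injB injR by (rule inj_compose[rotated])
  ultimately have "surj (R \<circ> B)" by (rule linear_inj_imp_surj)
  have "surj B"
    unfolding surj_def
  proof
    fix g
    obtain x where "R g = (R \<circ> B) x" using \<open>surj (R \<circ> B)\<close> by (metis surjD)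
    then show "\<exists>x. g = B x" using injR by (auto dest: injD)
  qed
  with injB show ?thesis by (simp add: bij_def)
qed

lemma linear_inv_spd_operator:
  assumes "spd_operator B"
  shows "linear (inv B)"
proof -
  have lin: "linear B" using assms by (simp add: spd_operator_def)
  have bij: "bij B" using assms by (rule spd_operator_bij)
  have eq: "B (inv B g) = g" for g using bij by (simp add: bij_is_surj surj_f_inv_f)
  have eq': "inv B (B x) = x" for x using bij by (simp add: bij_is_inj)
  show ?thesis
  proof (rule linearI)
    show "inv B (g + h) = inv B g + inv B h" for g h
      using eq'[of "inv B g + inv B h"] by (simp add: eq linear_add[OF lin])
    show "inv B (r *\<^sub>R g) = r *\<^sub>R inv B g" for r g
      using eq'[of "r *\<^sub>R inv B g"] by (simp add: eq linear_scale[OF lin])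
  qed
qed

lemma dual_norm_squared:
  assumes "spd_operator B"
  shows "(dual_norm B g)\<^sup>2 = blinfun_apply g (inv B g)"
proof -
  have eq: "B (inv B g) = g"
    using spd_operator_bij[OF assms] by (simp add: bij_is_surj surj_f_inv_f)
  have "blinfun_apply (B x) x \<ge> 0" for x
    using assms by (cases "x = 0") (auto simp: spd_operator_def intro: less_imp_le)
  from this[of "inv B g"] show ?thesis by (simp add: dual_norm_def eq)
qed

lemma compact_std_simplex: "compact (std_simplex :: (real ^ 'm) set)"
proof (rule compact_Int_closed[of "cbox 0 1" "std_simplex", THEN back_subst[of compact]])
  show "compact (cbox 0 1 :: (real ^ 'm) set)" by simp
  have eq: "(std_simplex :: (real ^ 'm) set) =
      (\<Inter>i. {l. 0 \<le> l $ i}) \<inter> {l. (\<Sum>i\<in>UNIV. l $ i) = 1}"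
    by (auto simp: std_simplex_def)
  show "closed (std_simplex :: (real ^ 'm) set)"
    unfolding eq
    by (intro closed_Int closed_INT ballI closed_Collect_le closed_Collect_eq continuous_intros)
  show "cbox 0 1 \<inter> std_simplex = (std_simplex :: (real ^ 'm) set)"
  proof -
    have "l $ i \<le> 1" if "l \<in> std_simplex" for l :: "real ^ 'm" and i
      using that member_le_sum[of i UNIV "\<lambda>i. l $ i"] by (auto simp: std_simplex_def)
    then show ?thesis by (auto simp: mem_box_cart std_simplex_def)
  qed
qed

lemma std_simplex_nonempty: "(std_simplex :: (real ^ 'm) set) \<noteq> {}"
proof -
  have "axis i 1 \<in> (std_simplex :: (real ^ 'm) set)" for i
    by (auto simp: std_simplex_def axis_def)
  then show ?thesis by blast
qed

lemma model_bound_attained: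
  fixes B :: "'a::euclidean_space \<Rightarrow> 'a dual" and G :: "('a dual) ^ 'm"
  assumes B: "spd_operator B"
  shows "\<exists>l\<in>std_simplex. model_bound B L fs G y = bound_objective B L fs G y l \<and>
           (\<forall>l'\<in>std_simplex. bound_objective B L fs G y l' \<le> bound_objective B L fs G y l)"
proof -
  have linG: "linear (lin_apply G)"
    by (rule linearI)
      (simp_all add: lin_apply_def scaleR_add_left sum.distrib scaleR_sum_right)
  have "continuous_on std_simplex (lin_apply G)"
    using linG by (rule linear_continuous_on[OF linear_conv_bounded_linear[THEN iffD1]])
  moreover have "continuous_on std_simplex (inv B \<circ> lin_apply G)"
    using linear_compose[OF linG linear_inv_spd_operator[OF B]]
    by (rule linear_continuous_on[OF linear_conv_bounded_linear[THEN iffD1]])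
  ultimately have "continuous_on std_simplex (bound_objective B L fs G y)"
    unfolding bound_objective_def dual_norm_squared[OF B] comp_def
    by (intro continuous_intros)
  from continuous_attains_sup[OF compact_std_simplex std_simplex_nonempty this]
  obtain l where l: "l \<in> std_simplex"
    "\<forall>l'\<in>std_simplex. bound_objective B L fs G y l' \<le> bound_objective B L fs G y l"
    by blast
  then have "model_bound B L fs G y = bound_objective B L fs G y l"
    unfolding model_bound_def by (intro cSup_eq_maximum) auto
  with l show ?thesis by blast
qed

end

theory Submission
  imports Defs
begin

text \<open>
  A weight \<open>l\<close> of the derived model induces the weight \<open>T l\<close> of the full history. The linear terms
  and \<open>G\<close> applied to the weight agree for both, while the squared norms of the aggregated columns
  are at most the averages of the original ones, because the squared dual norm is convex.
\<close>

text \<open>Expand the nonnegative \<open>B\<close>-square of \<open>inv B g - u\<close>. Equality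
  holds at \<open>u = inv B g\<close>, so the squared dual norm is a supremum of functions affine in
  \<open>g\<close>, which is the source of its convexity.\<close>

lemma dual_norm_squared_ge:
  assumes B: "spd_operator B"
  shows "2 * blinfun_apply g u - blinfun_apply (B u) u \<le> (dual_norm B g)\<^sup>2"
proof -
  have eq: "B (inv B g) = g"
    using spd_operator_bij[OF B] by (simp add: bij_is_surj surj_f_inv_f)
  have lin: "linear B" and sym: "\<And>x y. blinfun_apply (B x) y = blinfun_apply (B y) x"
    using B by (auto simp: spd_operator_def)
  have "0 \<le> blinfun_apply (B (inv B g - u)) (inv B g - u)"
    using B by (cases "inv B g - u = 0") (auto simp: spd_operator_def intro: less_imp_le)
  \<comment> \<open>By symmetry of \<open>B\<close> both cross terms equal \<open>g\<close> at
    \<open>u\<close>.\<close>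
  also have "\<dots> = blinfun_apply g (inv B g) - 2 * blinfun_apply g u + blinfun_apply (B u) u"
    using sym[of u "inv B g"]
    by (simp add: linear_diff[OF lin] eq blinfun.diff_left blinfun.diff_right)
  finally show ?thesis by (simp add: dual_norm_squared[OF B])
qed

text \<open>Jensen's inequality for the squared dual norm, proved by averaging one affine minorant
  over the columns.\<close>

lemma dual_norm_squared_lin_apply_le:
  fixes G :: "('a::euclidean_space dual) ^ 'm"
  assumes B: "spd_operator B" and w: "w \<in> std_simplex"
  shows "(dual_norm B (lin_apply G w))\<^sup>2 \<le> w \<bullet> col_sq_norms B G"
proof -
  \<comment> \<open>This \<open>u\<close> makes \<open>dual_norm_squared_ge\<close> an equality for
    the averaged functional; the same \<open>u\<close> then serves for every column.\<close>
  define u where "u = inv B (lin_apply G w)"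
  have eq: "B u = lin_apply G w"
    using spd_operator_bij[OF B] by (simp add: u_def bij_is_surj surj_f_inv_f)
  have w0: "\<And>i. 0 \<le> w $ i" and w1: "(\<Sum>i\<in>UNIV. w $ i) = 1"
    using w by (auto simp: std_simplex_def)
  \<comment> \<open>The total weight, equal to 1, is inserted as a factor so that the quadratic term
    can be distributed over the columns.\<close>
  have "(dual_norm B (lin_apply G w))\<^sup>2
      = 2 * blinfun_apply (lin_apply G w) u - (\<Sum>i\<in>UNIV. w $ i) * blinfun_apply (B u) u"
    by (simp add: dual_norm_squared[OF B] w1 eq flip: u_def)
  also have "\<dots> = (\<Sum>i\<in>UNIV. w $ i * (2 * blinfun_apply (G $ i) u - blinfun_apply (B u) u))"
    by (simp add: lin_apply_def blinfun.sum_left blinfun.scaleR_left sum_distrib_left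
        sum_distrib_right sum_subtractf right_diff_distrib mult.left_commute)
  also have "\<dots> \<le> w \<bullet> col_sq_norms B G"
    unfolding inner_vec_def
    by (auto intro!: sum_mono mult_left_mono w0 dual_norm_squared_ge[OF B]
        simp: col_sq_norms_def)
  finally show ?thesis .
qed

text \<open>\<open>T *v l\<close> is a convex combination of the columns of \<open>T\<close>; after
  exchanging sums, its total mass is the \<open>l\<close>-average of column sums equal to 1.\<close>

lemma matrix_vector_mult_in_std_simplex:
  fixes T :: "real ^ 'k ^ 'm"
  assumes T: "\<And>i. column i T \<in> std_simplex" and l: "l \<in> std_simplex"
  shows "T *v l \<in> std_simplex"
proof -
  have T0: "0 \<le> T $ i $ j" and T1: "(\<Sum>i\<in>UNIV. T $ i $ j) = 1" for i j
    using T[of j] by (auto simp: std_simplex_def column_def)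
  have "(\<Sum>i\<in>UNIV. (T *v l) $ i) = (\<Sum>j\<in>UNIV. (\<Sum>i\<in>UNIV. T $ i $ j) * l $ j)"
    unfolding matrix_vector_mult_def sum_distrib_right by (simp add: sum.swap[of _ "UNIV :: 'k set"])
  with l T0 show ?thesis
    by (auto simp: std_simplex_def T1 matrix_vector_mult_def intro!: sum_nonneg)
qed

lemma inner_matrix_vector_mult:
  fixes T :: "real ^ 'k ^ 'm"
  shows "(T *v l) \<bullet> v = l \<bullet> (transpose T *v v)"
  by (metis dot_lmul_matrix inner_commute transpose_matrix_vector)

text \<open>Associativity of composition; it makes the quadratic terms of the two objectives
  coincide.\<close>

lemma lin_apply_derived_G:
  "lin_apply (derived_G T G) l = lin_apply G (T *v l)"
proof -
  have "lin_apply (derived_G T G) l = (\<Sum>j\<in>UNIV. \<Sum>i\<in>UNIV. (T $ i $ j * l $ j) *\<^sub>R G $ i)"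
    by (simp add: lin_apply_def derived_G_def column_def scaleR_sum_right mult.commute)
  also have "\<dots> = lin_apply G (T *v l)"
    by (subst sum.swap) (simp add: lin_apply_def matrix_vector_mult_def scaleR_sum_left)
  finally show ?thesis .
qed

lemma lin_transpose_derived_G:
  "lin_transpose (derived_G T G) y = transpose T *v lin_transpose G y"
  by (simp add: vec_eq_iff lin_transpose_def derived_G_def lin_apply_def column_def transpose_def
      matrix_vector_mult_def blinfun.sum_left blinfun.scaleR_left)

text \<open>Column \<open>j\<close> of \<open>T\<close> supplies the weights in Jensen's
  inequality.\<close>

lemma col_sq_norms_derived_G_le:
  assumes "spd_operator B" and "column j T \<in> std_simplex"
  shows "col_sq_norms B (derived_G T G) $ j \<le> (transpose T *v col_sq_norms B G) $ j"
  using dual_norm_squared_lin_apply_le[OF assms, of G]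
  by (simp add: col_sq_norms_def derived_G_def matrix_vector_mult_def transpose_def column_def
      inner_vec_def)

text \<open>Moving \<open>T\<close> across the inner product matches all terms exactly except the
  squared column norms, which enter with the positive factor \<open>1 / (2 * L)\<close>.\<close>

lemma bound_objective_derived_le:
  fixes T :: "real ^ 'k ^ 'm"
  assumes B: "spd_operator B" and L: "L > 0"
    and T: "\<And>i. column i T \<in> std_simplex" and l: "l \<in> std_simplex"
  shows "bound_objective B L (derived_fstar T fs) (derived_G T G) y l
    \<le> bound_objective B L fs G y (T *v l)"
proof -
  have "l \<bullet> col_sq_norms B (derived_G T G) \<le> l \<bullet> (transpose T *v col_sq_norms B G)"
    unfolding inner_vec_def using l col_sq_norms_derived_G_le[OF B T, where G = G]
    by (auto simp: std_simplex_def intro!: sum_mono mult_left_mono)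
  with L have "1 / (2 * L) * (l \<bullet> col_sq_norms B (derived_G T G))
      \<le> 1 / (2 * L) * (l \<bullet> (transpose T *v col_sq_norms B G))"
    by (intro mult_left_mono) auto
  then show ?thesis
    by (simp add: bound_objective_def lin_apply_derived_G lin_transpose_derived_G derived_fstar_def
        inner_add_right inner_diff_right inner_matrix_vector_mult)
qed

theorem proposition2p9:
  fixes f :: "'a::euclidean_space \<Rightarrow> real"
    and B grad :: "'a \<Rightarrow> 'a dual"
    and L :: real
    and z :: "'a ^ 'm"
    and T :: "real ^ 'k ^ 'm"
    and y :: 'a
  assumes "spd_operator B"
    and "convex_on UNIV f"
    and "has_gradient f grad"
    and "L > 0"
    and "lipschitz_gradient B L grad"
    and "\<And>i. column i T \<in> std_simplex"
  shows "derived_bound B L f grad z T y \<le> full_bound B L f grad z y"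
proof -
  let ?fs = "history_fstar f grad z" and ?G = "history_G grad z"
  obtain l :: "real ^ 'k" where l: "l \<in> std_simplex"
    and "derived_bound B L f grad z T y
      = bound_objective B L (derived_fstar T ?fs) (derived_G T ?G) y l"
    unfolding derived_bound_def using model_bound_attained[OF assms(1)] by blast
  then have "derived_bound B L f grad z T y \<le> bound_objective B L ?fs ?G y (T *v l)"
    using bound_objective_derived_le[OF assms(1,4,6) l] by simp
  also have "\<dots> \<le> full_bound B L f grad z y"
    unfolding full_bound_def
    \<comment> \<open>Attainment also shows that the bound dominates the objective at every weight
      in the simplex, in particular at \<open>T *v l\<close>.\<close>
    using model_bound_attained[OF assms(1), of L ?fs ?G y]
      matrix_vector_mult_in_std_simplex[OF assms(6) l]
    by auto
  finally show ?thesis .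
qed

end
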